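(* Let $T$ be a complete countable first-order theory with monster model $\mathcal U$, let $M$ be a countable model of $T$, and let $p(x)\in S(\mathcal U)$ be a global type which is finitely satisfiable in $M$. Let $(d_i)_{i<\omega}$ be a Morley sequence of $p$ over $M$. If $(d_i)$ converges, then there is a sequence $(c_i)_{i<\omega}$ of tuples from $M$ such that $tp(c_i/\mathcal U)\to p$.
   Context: A global type finitely satisfiable in $M$ is $M$-invariant; its Morley sequence over $M$ is a sequence $(d_i)_{i<\omega}$ with $d_i\models p|_{M d_{<i}}$ for all $i$. A sequence $(d_i)$ of tuples in $\mathcal U$ converges if the sequence $(tp(d_i/\mathcal U))_{i<\omega}$ converges in the Stone (logic) topology, i.e. for every $L(\mathcal U)$-formula $\phi(x)$ the truth value of $\phi(d_i)$ is eventually constant. $tp(c_i/\mathcal U)\to p$ means: for every $L(\mathcal U)$-formula $\phi(x)$, $\phi(x)\in p$ iff $\phi(c_i)$ holds for all sufficiently large $i$. *)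

theory Defs
  imports "HOL-Analysis.Analysis"
begin

unbundle cardinal_syntax

section \<open>First-order logic\<close>

datatype 'f tm = Var nat | App 'f "'f tm list"

datatype ('f, 'r) fm =
    Eq "'f tm" "'f tm"
  | Atom 'r "'f tm list"
  | Neg "('f, 'r) fm"
  | And "('f, 'r) fm" "('f, 'r) fm"
  | Exists nat "('f, 'r) fm"

record ('f, 'r) lang =
  funs :: "'f set"
  farity :: "'f \<Rightarrow> nat"
  rels :: "'r set"
  rarity :: "'r \<Rightarrow> nat"

record ('f, 'r, 'u) struct =
  univ :: "'u set"
  fint :: "'f \<Rightarrow> 'u list \<Rightarrow> 'u"
  rint :: "'r \<Rightarrow> 'u list \<Rightarrow> bool"

definition countable_lang :: "('f, 'r) lang \<Rightarrow> bool" where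
  "countable_lang L \<longleftrightarrow> countable (funs L) \<and> countable (rels L)"

fun wf_tm :: "('f, 'r) lang \<Rightarrow> 'f tm \<Rightarrow> bool" where
  "wf_tm L (Var i) \<longleftrightarrow> True"
| "wf_tm L (App f ts) \<longleftrightarrow> f \<in> funs L \<and> length ts = farity L f \<and> (\<forall>t\<in>set ts. wf_tm L t)"

fun wf_fm :: "('f, 'r) lang \<Rightarrow> ('f, 'r) fm \<Rightarrow> bool" where
  "wf_fm L (Eq s t) \<longleftrightarrow> wf_tm L s \<and> wf_tm L t"
| "wf_fm L (Atom r ts) \<longleftrightarrow> r \<in> rels L \<and> length ts = rarity L r \<and> (\<forall>t\<in>set ts. wf_tm L t)"
| "wf_fm L (Neg \<phi>) \<longleftrightarrow> wf_fm L \<phi>"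
| "wf_fm L (And \<phi> \<psi>) \<longleftrightarrow> wf_fm L \<phi> \<and> wf_fm L \<psi>"
| "wf_fm L (Exists i \<phi>) \<longleftrightarrow> wf_fm L \<phi>"

fun fv_tm :: "'f tm \<Rightarrow> nat set" where
  "fv_tm (Var i) = {i}"
| "fv_tm (App f ts) = (\<Union>t\<in>set ts. fv_tm t)"

fun fv :: "('f, 'r) fm \<Rightarrow> nat set" where
  "fv (Eq s t) = fv_tm s \<union> fv_tm t"
| "fv (Atom r ts) = (\<Union>t\<in>set ts. fv_tm t)"
| "fv (Neg \<phi>) = fv \<phi>"
| "fv (And \<phi> \<psi>) = fv \<phi> \<union> fv \<psi>"
| "fv (Exists i \<phi>) = fv \<phi> - {i}"

text \<open>The \<open>L\<close>-formulas \<open>\<phi>(x\<^sub>0, \<dots>, x\<^sub>n\<^sub>-\<^sub>1)\<close>; for \<open>n = 0\<close> these are the \<open>L\<close>-sentences.\<close>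

definition formulas :: "('f, 'r) lang \<Rightarrow> nat \<Rightarrow> ('f, 'r) fm set" where
  "formulas L n = {\<phi>. wf_fm L \<phi> \<and> fv \<phi> \<subseteq> {..<n}}"

definition tuples :: "nat \<Rightarrow> 'u set \<Rightarrow> 'u list set" where
  "tuples n A = {xs. length xs = n \<and> set xs \<subseteq> A}"

definition is_struct :: "('f, 'r) lang \<Rightarrow> ('f, 'r, 'u) struct \<Rightarrow> bool" where
  "is_struct L N \<longleftrightarrow> univ N \<noteq> {} \<and>
     (\<forall>f\<in>funs L. \<forall>xs\<in>tuples (farity L f) (univ N). fint N f xs \<in> univ N)"

fun eval :: "('f, 'r, 'u) struct \<Rightarrow> (nat \<Rightarrow> 'u) \<Rightarrow> 'f tm \<Rightarrow> 'u" where
  "eval N e (Var i) = e i"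
| "eval N e (App f ts) = fint N f (map (eval N e) ts)"

fun sat :: "('f, 'r, 'u) struct \<Rightarrow> (nat \<Rightarrow> 'u) \<Rightarrow> ('f, 'r) fm \<Rightarrow> bool" where
  "sat N e (Eq s t) \<longleftrightarrow> eval N e s = eval N e t"
| "sat N e (Atom r ts) \<longleftrightarrow> rint N r (map (eval N e) ts)"
| "sat N e (Neg \<phi>) \<longleftrightarrow> \<not> sat N e \<phi>"
| "sat N e (And \<phi> \<psi>) \<longleftrightarrow> sat N e \<phi> \<and> sat N e \<psi>"
| "sat N e (Exists i \<phi>) \<longleftrightarrow> (\<exists>a\<in>univ N. sat N (e(i := a)) \<phi>)"

text \<open>
  Truth of \<open>\<phi>(d)\<close> for a tuple \<open>d\<close>: it interprets \<open>x\<^sub>i\<close> as the \<open>i\<close>-th entry of \<open>d\<close>. It is only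
  used when the free variables of \<open>\<phi>\<close> are below the length of \<open>d\<close>, so that the unspecified
  entries beyond that length play no role.
\<close>

definition holds_at :: "('f, 'r, 'u) struct \<Rightarrow> ('f, 'r) fm \<Rightarrow> 'u list \<Rightarrow> bool" where
  "holds_at N \<phi> d \<longleftrightarrow> sat N (\<lambda>i. d ! i) \<phi>"

definition is_model :: "('f, 'r) lang \<Rightarrow> ('f, 'r, 'u) struct \<Rightarrow> ('f, 'r) fm set \<Rightarrow> bool" where
  "is_model L N T \<longleftrightarrow> is_struct L N \<and> (\<forall>\<phi>\<in>T. holds_at N \<phi> [])"

text \<open>
  A theory \<open>T\<close> is complete if it has a model and for every sentence \<open>\<phi>\<close> either \<open>T \<Turnstile> \<phi>\<close> or
  \<open>T \<Turnstile> \<not>\<phi>\<close>. HOL cannot quantify over structures of all types inside a formula. Since the notion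
  is only used for countable languages, by the downward Loewenheim--Skolem theorem it is enough
  to consider the structures whose universe is a set of natural numbers (finite or infinite).
\<close>

definition entails :: "('f, 'r) lang \<Rightarrow> ('f, 'r) fm set \<Rightarrow> ('f, 'r) fm \<Rightarrow> bool" where
  "entails L T \<phi> \<longleftrightarrow> (\<forall>N :: ('f, 'r, nat) struct. is_model L N T \<longrightarrow> holds_at N \<phi> [])"

definition complete_theory :: "('f, 'r) lang \<Rightarrow> ('f, 'r) fm set \<Rightarrow> bool" where
  "complete_theory L T \<longleftrightarrow> T \<subseteq> formulas L 0 \<and>
     (\<exists>N :: ('f, 'r, nat) struct. is_model L N T) \<and>
     (\<forall>\<phi>\<in>formulas L 0. entails L T \<phi> \<or> entails L T (Neg \<phi>))"

text \<open>Agreement on atomic formulas makes \<open>M\<close> a substructure of \<open>N\<close>.\<close>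

definition elem_substruct ::
  "('f, 'r) lang \<Rightarrow> ('f, 'r, 'u) struct \<Rightarrow> ('f, 'r, 'u) struct \<Rightarrow> bool" where
  "elem_substruct L M N \<longleftrightarrow> is_struct L M \<and> is_struct L N \<and> univ M \<subseteq> univ N \<and>
     (\<forall>n. \<forall>\<phi>\<in>formulas L n. \<forall>a\<in>tuples n (univ M). holds_at M \<phi> a \<longleftrightarrow> holds_at N \<phi> a)"

section \<open>Types\<close>

text \<open>The language \<open>L(A)\<close>, in which \<open>Inr a\<close> is a constant symbol naming \<open>a \<in> A\<close>, and the
  corresponding expansion of a structure. An interpretation is a total function on symbols, so
  one expansion, naming everything, serves all sets of parameters \<open>A\<close>.\<close>

definition lang_with :: "('f, 'r) lang \<Rightarrow> 'u set \<Rightarrow> ('f + 'u, 'r) lang" where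
  "lang_with L A = \<lparr>funs = Inl ` funs L \<union> Inr ` A, farity = case_sum (farity L) (\<lambda>_. 0),
     rels = rels L, rarity = rarity L\<rparr>"

definition named :: "('f, 'r, 'u) struct \<Rightarrow> ('f + 'u, 'r, 'u) struct" where
  "named N = \<lparr>univ = univ N, fint = case_sum (fint N) (\<lambda>a _. a), rint = rint N\<rparr>"

abbreviation formulas_over :: "('f, 'r) lang \<Rightarrow> 'u set \<Rightarrow> nat \<Rightarrow> ('f + 'u, 'r) fm set" where
  "formulas_over L A n \<equiv> formulas (lang_with L A) n"

definition realizes :: "('f, 'r, 'u) struct \<Rightarrow> nat \<Rightarrow> 'u list \<Rightarrow> ('f + 'u, 'r) fm set \<Rightarrow> bool" where
  "realizes N n d q \<longleftrightarrow> d \<in> tuples n (univ N) \<and> (\<forall>\<phi>\<in>q. holds_at (named N) \<phi> d)"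

text \<open>\<open>S\<^sub>n(A)\<close>: the complete \<open>n\<close>-types over \<open>A\<close>. Every finite part is realized in \<open>N\<close>, i.e. the
  type is consistent with the elementary diagram of \<open>N\<close>.\<close>

definition types ::
  "('f, 'r) lang \<Rightarrow> ('f, 'r, 'u) struct \<Rightarrow> 'u set \<Rightarrow> nat \<Rightarrow> ('f + 'u, 'r) fm set set" where
  "types L N A n = {q. q \<subseteq> formulas_over L A n \<and>
     (\<forall>\<Phi>\<subseteq>q. finite \<Phi> \<longrightarrow> (\<exists>d. realizes N n d \<Phi>)) \<and>
     (\<forall>\<phi>\<in>formulas_over L A n. \<phi> \<in> q \<or> Neg \<phi> \<in> q)}"

definition tp ::
  "('f, 'r) lang \<Rightarrow> ('f, 'r, 'u) struct \<Rightarrow> 'u set \<Rightarrow> nat \<Rightarrow> 'u list \<Rightarrow> ('f + 'u, 'r) fm set" where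
  "tp L N A n d = {\<phi> \<in> formulas_over L A n. holds_at (named N) \<phi> d}"

definition restrict_type ::
  "('f, 'r) lang \<Rightarrow> nat \<Rightarrow> ('f + 'u, 'r) fm set \<Rightarrow> 'u set \<Rightarrow> ('f + 'u, 'r) fm set" where
  "restrict_type L n p A = p \<inter> formulas_over L A n"

definition stone_space ::
  "('f, 'r) lang \<Rightarrow> ('f, 'r, 'u) struct \<Rightarrow> 'u set \<Rightarrow> nat \<Rightarrow> ('f + 'u, 'r) fm set topology" where
  "stone_space L N A n =
     topology_generated_by ((\<lambda>\<phi>. {q \<in> types L N A n. \<phi> \<in> q}) ` formulas_over L A n)"

section \<open>The monster model\<close>

definition saturated :: "'k rel \<Rightarrow> ('f, 'r) lang \<Rightarrow> ('f, 'r, 'u) struct \<Rightarrow> bool" where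
  "saturated \<kappa> L N \<longleftrightarrow>
     (\<forall>A n. A \<subseteq> univ N \<longrightarrow> |A| <o \<kappa> \<longrightarrow> (\<forall>q\<in>types L N A n. \<exists>d. realizes N n d q))"

definition partial_elem ::
  "('f, 'r) lang \<Rightarrow> ('f, 'r, 'u) struct \<Rightarrow> 'u set \<Rightarrow> ('u \<Rightarrow> 'u) \<Rightarrow> bool" where
  "partial_elem L N A g \<longleftrightarrow> A \<subseteq> univ N \<and> g ` A \<subseteq> univ N \<and>
     (\<forall>n. \<forall>\<phi>\<in>formulas L n. \<forall>a\<in>tuples n A. holds_at N \<phi> a \<longleftrightarrow> holds_at N \<phi> (map g a))"

definition automorphism :: "('f, 'r) lang \<Rightarrow> ('f, 'r, 'u) struct \<Rightarrow> ('u \<Rightarrow> 'u) \<Rightarrow> bool" where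
  "automorphism L N \<sigma> \<longleftrightarrow> bij_betw \<sigma> (univ N) (univ N) \<and>
     (\<forall>f\<in>funs L. \<forall>xs\<in>tuples (farity L f) (univ N). \<sigma> (fint N f xs) = fint N f (map \<sigma> xs)) \<and>
     (\<forall>r\<in>rels L. \<forall>xs\<in>tuples (rarity L r) (univ N). rint N r xs \<longleftrightarrow> rint N r (map \<sigma> xs))"

definition strongly_homogeneous :: "'k rel \<Rightarrow> ('f, 'r) lang \<Rightarrow> ('f, 'r, 'u) struct \<Rightarrow> bool" where
  "strongly_homogeneous \<kappa> L N \<longleftrightarrow>
     (\<forall>A g. |A| <o \<kappa> \<longrightarrow> partial_elem L N A g \<longrightarrow>
        (\<exists>\<sigma>. automorphism L N \<sigma> \<and> (\<forall>a\<in>A. \<sigma> a = g a)))"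

text \<open>\<open>\<kappa>\<close> is the bound below which sets are small. Everything that has to be small here is
  countable, so the only largeness demanded of \<open>\<kappa>\<close> is that it is uncountable.\<close>

definition monster_model ::
  "'k rel \<Rightarrow> ('f, 'r) lang \<Rightarrow> ('f, 'r) fm set \<Rightarrow> ('f, 'r, 'u) struct \<Rightarrow> bool" where
  "monster_model \<kappa> L T U \<longleftrightarrow> Card_order \<kappa> \<and> natLeq <o \<kappa> \<and> is_model L U T \<and>
     saturated \<kappa> L U \<and> strongly_homogeneous \<kappa> L U"

section \<open>Global types, Morley sequences, convergence\<close>

abbreviation global_types ::
  "('f, 'r) lang \<Rightarrow> ('f, 'r, 'u) struct \<Rightarrow> nat \<Rightarrow> ('f + 'u, 'r) fm set set" where
  "global_types L U n \<equiv> types L U (univ U) n"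

definition finitely_satisfiable_in ::
  "('f, 'r, 'u) struct \<Rightarrow> nat \<Rightarrow> ('f + 'u, 'r) fm set \<Rightarrow> 'u set \<Rightarrow> bool" where
  "finitely_satisfiable_in U n p A \<longleftrightarrow> (\<forall>\<phi>\<in>p. \<exists>a\<in>tuples n A. holds_at (named U) \<phi> a)"

definition morley_sequence ::
  "('f, 'r) lang \<Rightarrow> ('f, 'r, 'u) struct \<Rightarrow> nat \<Rightarrow> ('f + 'u, 'r) fm set \<Rightarrow> 'u set \<Rightarrow>
     (nat \<Rightarrow> 'u list) \<Rightarrow> bool" where
  "morley_sequence L U n p A d \<longleftrightarrow>
     (\<forall>i. realizes U n (d i) (restrict_type L n p (A \<union> (\<Union>j<i. set (d j)))))"

definition types_tend_to ::
  "('f, 'r) lang \<Rightarrow> ('f, 'r, 'u) struct \<Rightarrow> nat \<Rightarrow> (nat \<Rightarrow> 'u list) \<Rightarrow>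
     ('f + 'u, 'r) fm set \<Rightarrow> bool" where
  "types_tend_to L U n c p \<longleftrightarrow>
     limitin (stone_space L U (univ U) n) (\<lambda>i. tp L U (univ U) n (c i)) p sequentially"

definition converges ::
  "('f, 'r) lang \<Rightarrow> ('f, 'r, 'u) struct \<Rightarrow> nat \<Rightarrow> (nat \<Rightarrow> 'u list) \<Rightarrow> bool" where
  "converges L U n d \<longleftrightarrow> (\<exists>p\<in>global_types L U n. types_tend_to L U n d p)"

subsection \<open>Convergence in terms of formulas\<close>

lemma tp_in_types:
  assumes "d \<in> tuples n (univ N)"
  shows "tp L N A n d \<in> types L N A n"
  using assms by (auto simp: types_def tp_def realizes_def holds_at_def formulas_def)

lemma limitin_topology_generated_by:
  "limitin (topology_generated_by B) f l F \<longleftrightarrow>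
     l \<in> \<Union>B \<and> (\<forall>b\<in>B. l \<in> b \<longrightarrow> eventually (\<lambda>i. f i \<in> b) F)"
proof
  assume "limitin (topology_generated_by B) f l F"
  then show "l \<in> \<Union>B \<and> (\<forall>b\<in>B. l \<in> b \<longrightarrow> eventually (\<lambda>i. f i \<in> b) F)"
    by (auto simp: limitin_def intro: topology_generated_by_Basis)
next
  assume *: "l \<in> \<Union>B \<and> (\<forall>b\<in>B. l \<in> b \<longrightarrow> eventually (\<lambda>i. f i \<in> b) F)"
  have "l \<in> V \<longrightarrow> eventually (\<lambda>i. f i \<in> V) F" if "generate_topology_on B V" for V
    using that
  proof induction
    case Empty
    show ?case by simp
  next
    case (Int a b)
    then show ?case by (simp add: eventually_conj_iff)
  next
    case (UN K)
    show ?case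
    proof
      assume "l \<in> \<Union>K"
      then obtain k where k: "k \<in> K" "l \<in> k" by blast
      with UN have "eventually (\<lambda>i. f i \<in> k) F" by blast
      then show "eventually (\<lambda>i. f i \<in> \<Union>K) F"
        by (rule eventually_mono) (use k in blast)
    qed
  next
    case (Basis b)
    then show ?case using * by blast
  qed
  then show "limitin (topology_generated_by B) f l F"
    using * unfolding limitin_def openin_topology_generated_by_iff topology_generated_by_topspace
    by blast
qed

lemma Neg_in_formulas: "Neg \<phi> \<in> formulas L n \<longleftrightarrow> \<phi> \<in> formulas L n"
  by (simp add: formulas_def)

lemma types_consistent:
  assumes "q \<in> types L N A n" "\<phi> \<in> q"
  shows "Neg \<phi> \<notin> q"
proof
  assume "Neg \<phi> \<in> q"
  with assms have "\<exists>d. realizes N n d {\<phi>, Neg \<phi>}"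
    by (auto simp: types_def)
  then show False
    by (auto simp: realizes_def holds_at_def)
qed

lemma types_tend_to_iff:
  assumes c: "\<And>i. c i \<in> tuples n (univ U)" and p: "p \<in> global_types L U n"
  shows "types_tend_to L U n c p \<longleftrightarrow>
    (\<forall>\<phi>\<in>formulas_over L (univ U) n.
       \<phi> \<in> p \<longleftrightarrow> eventually (\<lambda>i. holds_at (named U) \<phi> (c i)) sequentially)"
    (is "_ \<longleftrightarrow> ?R")
proof -
  let ?F = "formulas_over L (univ U) n"
  have triv: "Exists 0 (Eq (Var 0) (Var 0)) \<in> ?F"
    by (auto simp: formulas_def)
  have "\<exists>\<phi>\<in>?F. \<phi> \<in> p"
    using p triv unfolding types_def by blast
  moreover have "tp L U (univ U) n (c i) \<in> {q \<in> global_types L U n. \<phi> \<in> q} \<longleftrightarrow>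
      holds_at (named U) \<phi> (c i)" if "\<phi> \<in> ?F" for \<phi> i
    using that tp_in_types[OF c] by (auto simp: tp_def)
  ultimately have "types_tend_to L U n c p \<longleftrightarrow>
      (\<forall>\<phi>\<in>?F. \<phi> \<in> p \<longrightarrow> eventually (\<lambda>i. holds_at (named U) \<phi> (c i)) sequentially)"
    using p unfolding types_tend_to_def stone_space_def limitin_topology_generated_by by simp
  moreover have "\<phi> \<in> p"
    if *: "\<forall>\<phi>\<in>?F. \<phi> \<in> p \<longrightarrow> eventually (\<lambda>i. holds_at (named U) \<phi> (c i)) sequentially"
      and \<phi>: "\<phi> \<in> ?F" and ev: "eventually (\<lambda>i. holds_at (named U) \<phi> (c i)) sequentially" for \<phi>
  proof (rule ccontr)
    assume "\<phi> \<notin> p"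
    then have "Neg \<phi> \<in> p"
      using p \<phi> by (auto simp: types_def)
    then have "eventually (\<lambda>i. holds_at (named U) (Neg \<phi>) (c i)) sequentially"
      using * \<phi> by (auto simp: Neg_in_formulas)
    with ev have "eventually (\<lambda>i. False) sequentially"
      by eventually_elim (simp add: holds_at_def)
    then show False by simp
  qed
  ultimately show ?thesis by blast
qed

lemma converges_iff:
  assumes d: "\<And>i. d i \<in> tuples n (univ U)"
  shows "converges L U n d \<longleftrightarrow>
    (\<forall>\<phi>\<in>formulas_over L (univ U) n.
       eventually (\<lambda>i. holds_at (named U) \<phi> (d i)) sequentially \<or>
       eventually (\<lambda>i. \<not> holds_at (named U) \<phi> (d i)) sequentially)"
    (is "_ \<longleftrightarrow> ?R")
proof
  assume "converges L U n d"
  then obtain p where p: "p \<in> global_types L U n" and "types_tend_to L U n d p"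
    unfolding converges_def by blast
  then have *: "\<phi> \<in> p \<longleftrightarrow> eventually (\<lambda>i. holds_at (named U) \<phi> (d i)) sequentially"
    if "\<phi> \<in> formulas_over L (univ U) n" for \<phi>
    using that types_tend_to_iff[where c = d, OF d p] by blast
  show ?R
  proof
    fix \<phi> assume \<phi>: "\<phi> \<in> formulas_over L (univ U) n"
    then have "\<phi> \<in> p \<or> Neg \<phi> \<in> p"
      using p by (auto simp: types_def)
    then show "eventually (\<lambda>i. holds_at (named U) \<phi> (d i)) sequentially \<or>
       eventually (\<lambda>i. \<not> holds_at (named U) \<phi> (d i)) sequentially"
      using *[of \<phi>] *[of "Neg \<phi>"] \<phi> by (auto simp: Neg_in_formulas holds_at_def)
  qed
next
  assume R: ?R
  define p where "p = {\<phi> \<in> formulas_over L (univ U) n.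
    eventually (\<lambda>i. holds_at (named U) \<phi> (d i)) sequentially}"
  have "\<exists>d. realizes U n d \<Phi>" if "\<Phi> \<subseteq> p" "finite \<Phi>" for \<Phi>
  proof -
    have "eventually (\<lambda>i. \<forall>\<phi>\<in>\<Phi>. holds_at (named U) \<phi> (d i)) sequentially"
      using that by (intro eventually_ball_finite) (auto simp: p_def)
    then show ?thesis
      using d unfolding realizes_def eventually_sequentially by blast
  qed
  moreover have "\<phi> \<in> p \<or> Neg \<phi> \<in> p" if "\<phi> \<in> formulas_over L (univ U) n" for \<phi>
    using R that by (auto simp: p_def Neg_in_formulas holds_at_def)
  ultimately have p: "p \<in> global_types L U n"
    by (auto simp: types_def p_def)
  moreover have "types_tend_to L U n d p"
    unfolding types_tend_to_iff[where c = d, OF d p] by (auto simp: p_def)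
  ultimately show "converges L U n d"
    unfolding converges_def by blast
qed

end

theory Submission
  imports Defs "HOL-Library.Countable_Set_Type"
begin

text \<open>
  Let \<open>D\<close> be the set of parameters from \<open>M\<close> and the \<open>d\<^sub>i\<close>. As \<open>D\<close> is countable and \<open>p\<close> is finitely
  satisfiable in \<open>M\<close>, there are \<open>c\<^sub>i\<close> in \<open>M\<close> with \<open>tp(c\<^sub>i/D) \<rightarrow> p|\<^sub>D\<close>; any such sequence works.
  Suppose \<open>\<phi>(x, b) \<in> p\<close> fails at infinitely many \<open>c\<^sub>i\<close>. Then every formula of \<open>p|\<^sub>D\<close> has solutions
  in \<open>M\<close> satisfying \<open>\<phi>(x, b)\<close> and solutions in \<open>M\<close> violating it. If no \<open>y\<close> made the truth
  values of \<open>\<phi>(d\<^sub>i, y)\<close>, \<open>i < N\<close>, alternate, then one could replace \<open>d\<^sub>N\<^sub>-\<^sub>1, \<dots>, d\<^sub>0\<close>, in this order,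
  by points of \<open>M\<close> along which \<open>\<phi>(x, b)\<close> alternates, preserving that no such \<open>y\<close> exists, which
  is absurd as \<open>y = b\<close> is one. By saturation a single \<open>b'\<close> then makes \<open>\<phi>(d\<^sub>i, b')\<close> alternate for all
  \<open>i\<close>, so \<open>(d\<^sub>i)\<close> does not converge.
\<close>

section \<open>Syntax and satisfaction\<close>

lemma eval_cong:
  assumes "\<And>i. i \<in> fv_tm t \<Longrightarrow> e i = e' i"
  shows "eval N e t = eval N e' t"
  using assms
proof (induction t)
  case (App f ts)
  then have "map (eval N e) ts = map (eval N e') ts" by auto
  then show ?case by (simp only: eval.simps)
qed simp

lemma sat_cong:
  assumes "\<And>i. i \<in> fv \<phi> \<Longrightarrow> e i = e' i"
  shows "sat N e \<phi> \<longleftrightarrow> sat N e' \<phi>"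
  using assms
proof (induction \<phi> arbitrary: e e')
  case (Eq s t)
  then show ?case using eval_cong[of s e e' N] eval_cong[of t e e' N] by simp
next
  case (Atom r ts)
  then have "map (eval N e) ts = map (eval N e') ts"
    by (auto intro!: eval_cong)
  then show ?case by (simp only: sat.simps)
next
  case (Neg \<phi>)
  then show ?case by (metis fv.simps(3) sat.simps(3))
next
  case (And \<phi> \<psi>)
  then show ?case by (metis Un_iff fv.simps(4) sat.simps(4))
next
  case (Exists i \<phi>)
  have "sat N (e(i := a)) \<phi> \<longleftrightarrow> sat N (e'(i := a)) \<phi>" for a
    by (rule Exists.IH) (use Exists.prems in auto)
  then show ?case by simp
qed

lemma univ_named [simp]: "univ (named N) = univ N"
  by (simp add: named_def)

section \<open>Bound variables, finite conjunctions and blocks of quantifiers\<close>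

fun bv :: "('f, 'r) fm \<Rightarrow> nat set" where
  "bv (Eq s t) = {}"
| "bv (Atom r ts) = {}"
| "bv (Neg \<phi>) = bv \<phi>"
| "bv (And \<phi> \<psi>) = bv \<phi> \<union> bv \<psi>"
| "bv (Exists i \<phi>) = insert i (bv \<phi>)"

lemma finite_bv: "finite (bv \<phi>)"
  by (induction \<phi>) auto

text \<open>The quantifier leaves no free variable, so empty conjunctions are available even when
  \<open>n = 0\<close>.\<close>

definition verum :: "('f, 'r) fm" where
  "verum = Exists 0 (Eq (Var 0) (Var 0))"

definition Conj :: "('f, 'r) fm list \<Rightarrow> ('f, 'r) fm" where
  "Conj \<phi>s = foldr And \<phi>s verum"

lemma sat_Conj:
  "univ N \<noteq> {} \<Longrightarrow> sat N e (Conj \<phi>s) \<longleftrightarrow> (\<forall>\<phi>\<in>set \<phi>s. sat N e \<phi>)"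
  by (induction \<phi>s) (auto simp: Conj_def verum_def)

lemma fv_Conj: "fv (Conj \<phi>s) = (\<Union>\<phi>\<in>set \<phi>s. fv \<phi>)"
  by (induction \<phi>s) (auto simp: Conj_def verum_def)

lemma wf_Conj: "wf_fm L (Conj \<phi>s) \<longleftrightarrow> (\<forall>\<phi>\<in>set \<phi>s. wf_fm L \<phi>)"
  by (induction \<phi>s) (auto simp: Conj_def verum_def)

lemma Conj_in_formulas: "Conj \<phi>s \<in> formulas L n \<longleftrightarrow> set \<phi>s \<subseteq> formulas L n"
  by (auto simp: formulas_def fv_Conj wf_Conj)

lemma sat_Exists_list:
  "sat N e (foldr Exists is \<phi>) \<longleftrightarrow>
     (\<exists>f. (\<forall>i\<in>set is. f i \<in> univ N) \<and> sat N (\<lambda>i. if i \<in> set is then f i else e i) \<phi>)"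
proof (induction "is" arbitrary: e)
  case Nil
  show ?case by simp
next
  case (Cons i "is")
  have "(\<exists>a\<in>univ N. \<exists>f. (\<forall>j\<in>set is. f j \<in> univ N) \<and>
      sat N (\<lambda>j. if j \<in> set is then f j else (e(i := a)) j) \<phi>) \<longleftrightarrow>
    (\<exists>f. (\<forall>j\<in>set (i # is). f j \<in> univ N) \<and>
      sat N (\<lambda>j. if j \<in> set (i # is) then f j else e j) \<phi>)" (is "?l \<longleftrightarrow> ?r")
  proof
    assume ?l
    then obtain a f where a: "a \<in> univ N" "\<forall>j\<in>set is. f j \<in> univ N"
      and s: "sat N (\<lambda>j. if j \<in> set is then f j else (e(i := a)) j) \<phi>" by blast
    have "(\<lambda>j. if j \<in> set is then f j else (e(i := a)) j) =
      (\<lambda>j. if j \<in> set (i # is) then (if j \<in> set is then f j else a) else e j)"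
      by auto
    with a s show ?r
      \<comment> \<open>If \<open>i\<close> occurs again in \<open>is\<close>, the inner quantifier
        overrides the outer value \<open>a\<close>.\<close>
      by (intro exI[of _ "\<lambda>j. if j \<in> set is then f j else a"]) auto
  next
    assume ?r
    then obtain f where f: "\<forall>j\<in>set (i # is). f j \<in> univ N"
      and s: "sat N (\<lambda>j. if j \<in> set (i # is) then f j else e j) \<phi>" by blast
    have "(\<lambda>j. if j \<in> set (i # is) then f j else e j) =
      (\<lambda>j. if j \<in> set is then f j else (e(i := f i)) j)"
      by auto
    with f s show ?l by auto
  qed
  then show ?case using Cons.IH by simp
qed

lemma fv_Exists_list: "fv (foldr Exists is \<phi>) = fv \<phi> - set is"
  by (induction "is") auto

lemma wf_Exists_list: "wf_fm L (foldr Exists is \<phi>) \<longleftrightarrow> wf_fm L \<phi>"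
  by (induction "is") auto

section \<open>Exchanging variables and parameters\<close>

fun inst_tm :: "(nat \<Rightarrow> 'u option) \<Rightarrow> ('f + 'u) tm \<Rightarrow> ('f + 'u) tm" where
  "inst_tm s (Var i) = (case s i of None \<Rightarrow> Var i | Some a \<Rightarrow> App (Inr a) [])"
| "inst_tm s (App f ts) = App f (map (inst_tm s) ts)"

text \<open>Only constants are substituted, so nothing can be captured; \<open>s(i := None)\<close>
  protects the bound variable.\<close>

fun inst :: "(nat \<Rightarrow> 'u option) \<Rightarrow> ('f + 'u, 'r) fm \<Rightarrow> ('f + 'u, 'r) fm" where
  "inst s (Eq t u) = Eq (inst_tm s t) (inst_tm s u)"
| "inst s (Atom r ts) = Atom r (map (inst_tm s) ts)"
| "inst s (Neg \<phi>) = Neg (inst s \<phi>)"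
| "inst s (And \<phi> \<psi>) = And (inst s \<phi>) (inst s \<psi>)"
| "inst s (Exists i \<phi>) = Exists i (inst (s(i := None)) \<phi>)"

lemma eval_inst:
  "eval (named N) e (inst_tm s t) = eval (named N) (\<lambda>i. case s i of None \<Rightarrow> e i | Some a \<Rightarrow> a) t"
proof (induction t)
  case (Var i)
  then show ?case by (simp add: named_def split: option.split)
next
  case (App f ts)
  then have "map (eval (named N) e \<circ> inst_tm s) ts =
    map (eval (named N) (\<lambda>i. case s i of None \<Rightarrow> e i | Some a \<Rightarrow> a)) ts" by simp
  then show ?case by (simp only: eval.simps inst_tm.simps list.map_comp)
qed

lemma sat_inst:
  "sat (named N) e (inst s \<phi>) \<longleftrightarrow> sat (named N) (\<lambda>i. case s i of None \<Rightarrow> e i | Some a \<Rightarrow> a) \<phi>"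
proof (induction \<phi> arbitrary: e s)
  case (Eq t u)
  then show ?case by (simp add: eval_inst)
next
  case (Atom r ts)
  then show ?case by (simp add: eval_inst comp_def)
next
  case (Exists i \<phi>)
  have "(\<lambda>j. case (s(i := None)) j of None \<Rightarrow> (e(i := a)) j | Some c \<Rightarrow> c) =
    (\<lambda>j. case s j of None \<Rightarrow> e j | Some c \<Rightarrow> c)(i := a)" for a
    by (rule ext) (simp split: option.split)
  then show ?case using Exists.IH by simp
qed simp_all

lemma fv_inst_tm: "fv_tm (inst_tm s t) = fv_tm t - dom s"
  by (induction t) (auto split: option.split)

lemma fv_inst: "fv (inst s \<phi>) = fv \<phi> - dom s"
  by (induction \<phi> arbitrary: s) (auto simp: fv_inst_tm)

lemma wf_inst_tm:
  "wf_tm (lang_with L A) t \<Longrightarrow> ran s \<subseteq> A \<Longrightarrow> wf_tm (lang_with L A) (inst_tm s t)"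
  by (induction t) (auto split: option.split simp: lang_with_def ran_def)

lemma wf_inst:
  "wf_fm (lang_with L A) \<phi> \<Longrightarrow> ran s \<subseteq> A \<Longrightarrow> wf_fm (lang_with L A) (inst s \<phi>)"
proof (induction \<phi> arbitrary: s)
  case (Exists i \<phi>)
  then have "ran (s(i := None)) \<subseteq> A" by (auto simp: ran_def split: if_splits)
  with Exists show ?case by simp
qed (auto simp: wf_inst_tm)

lemma wf_tm_mono: "wf_tm (lang_with L A) t \<Longrightarrow> A \<subseteq> B \<Longrightarrow> wf_tm (lang_with L B) t"
  by (induction t) (auto simp: lang_with_def)

lemma wf_fm_mono: "wf_fm (lang_with L A) \<phi> \<Longrightarrow> A \<subseteq> B \<Longrightarrow> wf_fm (lang_with L B) \<phi>"
proof (induction \<phi>)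
  case (Atom r ts)
  then show ?case by (auto simp: wf_tm_mono) (auto simp: lang_with_def)
qed (auto simp: wf_tm_mono)

lemma formulas_over_mono: "A \<subseteq> B \<Longrightarrow> formulas_over L A n \<subseteq> formulas_over L B n"
  by (auto simp: formulas_def intro: wf_fm_mono)

text \<open>
  Below, \<open>gen\<close> does not avoid capture: it is only meaningful if no \<open>g a\<close> is bound in the formula.
\<close>

fun gen_tm :: "('u \<Rightarrow> nat) \<Rightarrow> ('f + 'u) tm \<Rightarrow> ('f + 'u) tm" where
  "gen_tm g (Var i) = Var i"
| "gen_tm g (App f ts) =
     (case f of Inl h \<Rightarrow> App (Inl h) (map (gen_tm g) ts) | Inr a \<Rightarrow> Var (g a))"

fun gen :: "('u \<Rightarrow> nat) \<Rightarrow> ('f + 'u, 'r) fm \<Rightarrow> ('f + 'u, 'r) fm" where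
  "gen g (Eq t u) = Eq (gen_tm g t) (gen_tm g u)"
| "gen g (Atom r ts) = Atom r (map (gen_tm g) ts)"
| "gen g (Neg \<phi>) = Neg (gen g \<phi>)"
| "gen g (And \<phi> \<psi>) = And (gen g \<phi>) (gen g \<psi>)"
| "gen g (Exists i \<phi>) = Exists i (gen g \<phi>)"

lemma finite_set_tm: "finite (set_tm t)"
  by (induction t) auto

lemma finite_set1_fm: "finite (set1_fm \<phi>)"
  by (induction \<phi>) (auto simp: finite_set_tm)

lemma eval_gen:
  assumes "\<And>a. Inr a \<in> set_tm t \<Longrightarrow> e (g a) = a"
  shows "eval (named N) e (gen_tm g t) = eval (named N) e t"
  using assms
proof (induction t)
  case (App f ts)
  then have "map (eval (named N) e \<circ> gen_tm g) ts = map (eval (named N) e) ts" by auto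
  then show ?case
    using App.prems
    by (cases f) (simp_all only: eval.simps gen_tm.simps sum.case list.map_comp, simp add: named_def)
qed simp

text \<open>Since \<open>g a\<close> is never bound, the updates made by quantifiers keep
  \<open>e (g a) = a\<close>, which carries the induction.\<close>

lemma sat_gen:
  assumes "\<And>a. Inr a \<in> set1_fm \<phi> \<Longrightarrow> e (g a) = a \<and> g a \<notin> bv \<phi>"
  shows "sat (named N) e (gen g \<phi>) \<longleftrightarrow> sat (named N) e \<phi>"
  using assms
proof (induction \<phi> arbitrary: e)
  case (Eq t u)
  then show ?case by (simp add: eval_gen)
next
  case (Atom r ts)
  then have "map (eval (named N) e \<circ> gen_tm g) ts = map (eval (named N) e) ts"
    by (auto intro!: eval_gen)
  then show ?case by (simp only: sat.simps gen.simps list.map_comp)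
next
  case (Exists i \<phi>)
  have "sat (named N) (e(i := a)) (gen g \<phi>) \<longleftrightarrow> sat (named N) (e(i := a)) \<phi>" for a
    by (rule Exists.IH) (use Exists.prems in auto)
  then show ?case by simp
qed auto

lemma fv_gen_tm: "fv_tm (gen_tm g t) \<subseteq> fv_tm t \<union> g ` {a. Inr a \<in> set_tm t}"
proof (induction t)
  case (App f ts)
  then show ?case by (cases f) fastforce+
qed simp

lemma fv_gen: "fv (gen g \<phi>) \<subseteq> fv \<phi> \<union> g ` {a. Inr a \<in> set1_fm \<phi>}"
proof (induction \<phi>)
  case (Eq t u)
  then show ?case using fv_gen_tm[of g t] fv_gen_tm[of g u] by auto
next
  case (Atom r ts)
  then show ?case using fv_gen_tm[of g] by fastforce
qed auto

lemma wf_gen_tm: "wf_tm (lang_with L A) t \<Longrightarrow> wf_tm (lang_with L {}) (gen_tm g t)"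
  by (induction t) (auto simp: lang_with_def split: sum.split)

lemma wf_gen: "wf_fm (lang_with L A) \<phi> \<Longrightarrow> wf_fm (lang_with L {}) (gen g \<phi>)"
proof (induction \<phi>)
  case (Atom r ts)
  then show ?case using wf_gen_tm[of L A] by (auto simp: lang_with_def)
qed (auto simp: wf_gen_tm)

lemma wf_tm_params: "wf_tm (lang_with L A) t \<Longrightarrow> Inr a \<in> set_tm t \<Longrightarrow> a \<in> A"
  by (induction t) (auto simp: lang_with_def)

lemma wf_fm_params: "wf_fm (lang_with L A) \<phi> \<Longrightarrow> Inr a \<in> set1_fm \<phi> \<Longrightarrow> a \<in> A"
  by (induction \<phi>) (auto simp: wf_tm_params)

section \<open>Separating a formula from its parameters\<close>

definition splice :: "nat \<Rightarrow> 'u list \<Rightarrow> (nat \<Rightarrow> 'u) \<Rightarrow> nat \<Rightarrow> 'u" where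
  "splice n x e j = (if j < n then x ! j else e j)"

text \<open>This is the passage from \<open>\<phi>(x)\<close> over \<open>A\<close> to a
  parameter-free \<open>\<psi>(x, y)\<close> with \<open>y = b\<close>: a formula mentions finitely
  many constants, and each gets its own fresh variable.\<close>

lemma separate_parameters:
  fixes \<phi> :: "('f + 'u, 'r) fm" and N :: "('f, 'r, 'u) struct"
  assumes "\<phi> \<in> formulas_over L A n" and u: "u \<in> A"
  obtains \<psi> K b where "n \<le> K" "\<psi> \<in> formulas_over L {} K" "\<And>j. b j \<in> A"
    "\<And>x. holds_at (named N) \<phi> x \<longleftrightarrow> sat (named N) (splice n x b) \<psi>"
proof -
  define C where "C = {a. Inr a \<in> set1_fm \<phi>}"
  have "Inr ` C \<subseteq> set1_fm \<phi>" by (auto simp: C_def)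
  then have "finite C"
    using finite_set1_fm[of \<phi>] by (meson finite_imageD finite_subset inj_Inr inj_on_subset subset_UNIV)
  then obtain h :: "_ \<Rightarrow> nat" where h: "inj_on h C"
    using finite_imp_inj_to_nat_seg by metis
  obtain m where m: "\<And>j. j \<in> bv \<phi> \<Longrightarrow> j < m"
    using finite_bv[of \<phi>] by (auto simp: finite_nat_iff_bounded)
  \<comment> \<open>The offset \<open>n + m\<close> clears both the variables of \<open>x\<close>
    and all bound variables, so that \<open>gen\<close> captures nothing.\<close>
  define g where "g a = n + m + h a" for a
  have g: "inj_on g C" using h by (auto simp: g_def inj_on_def)
  obtain K0 where K0: "g ` C \<subseteq> {..<K0}"
    using finite_imageI[OF \<open>finite C\<close>, of g] by (auto simp: finite_nat_iff_bounded)
  define K where "K = max n K0"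
  \<comment> \<open>Positions that stand for no constant get the default \<open>u\<close>, which
    keeps every value of \<open>b\<close> in \<open>A\<close>.\<close>
  define b where "b j = (if j \<in> g ` C then the_inv_into C g j else u)" for j
  have b: "b (g a) = a" if "a \<in> C" for a
    using that g by (simp add: b_def the_inv_into_f_f)
  have wf: "wf_fm (lang_with L A) \<phi>" and fv: "fv \<phi> \<subseteq> {..<n}"
    using assms by (auto simp: formulas_def)
  show thesis
  proof
    show "n \<le> K" by (simp add: K_def)
    have "fv \<phi> \<union> g ` C \<subseteq> {..<K}"
      using fv K0 by (fastforce simp: K_def less_max_iff_disj)
    then have "fv (gen g \<phi>) \<subseteq> {..<K}"
      using fv_gen[of g \<phi>] unfolding C_def[symmetric] by blast
    then show "gen g \<phi> \<in> formulas_over L {} K"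
      using wf_gen[OF wf] by (simp add: formulas_def)
    have "C \<subseteq> A" using wf_fm_params[OF wf] by (auto simp: C_def)
    then have "b j \<in> A" if "j \<in> g ` C" for j
      using that by (auto simp: b)
    moreover have "b j = u" if "j \<notin> g ` C" for j
      using that by (simp add: b_def)
    ultimately show "b j \<in> A" for j using u by metis
    fix x
    have "sat (named N) (splice n x b) (gen g \<phi>) \<longleftrightarrow> sat (named N) (splice n x b) \<phi>"
    proof (rule sat_gen)
      fix a assume "Inr a \<in> set1_fm \<phi>"
      then have "b (g a) = a" using b by (simp add: C_def)
      moreover have "\<not> g a < n" "\<not> g a < m" by (simp_all add: g_def)
      ultimately show "splice n x b (g a) = a \<and> g a \<notin> bv \<phi>"
        using m by (auto simp: splice_def)
    qed
    also have "\<dots> \<longleftrightarrow> holds_at (named N) \<phi> x"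
      unfolding holds_at_def using fv by (intro sat_cong) (auto simp: splice_def)
    finally show "holds_at (named N) \<phi> x \<longleftrightarrow> sat (named N) (splice n x b) (gen g \<phi>)" by simp
  qed
qed

section \<open>Countability\<close>

instance tm :: (countable) countable
  by countable_datatype

instance fm :: (countable, countable) countable
  by countable_datatype

lemma wf_tm_symbols: "wf_tm L t \<Longrightarrow> set_tm t \<subseteq> funs L"
  by (induction t) auto

lemma wf_fm_symbols: "wf_fm L \<phi> \<Longrightarrow> set1_fm \<phi> \<subseteq> funs L \<and> set2_fm \<phi> \<subseteq> rels L"
proof (induction \<phi>)
  case (Atom r ts)
  then show ?case using wf_tm_symbols[of L] by fastforce
qed (auto dest: wf_tm_symbols)

text \<open>The symbol types may be uncountable, but a formula of \<open>L\<close> is unchanged when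
  its symbols are coded as natural numbers and decoded again. So all of them are decodings of
  formulas over \<open>nat\<close>, a countable type.\<close>

lemma countable_formulas:
  assumes "countable_lang L"
  shows "countable (formulas L n)"
proof -
  define f where "f = from_nat_into (funs L) \<circ> to_nat_on (funs L)"
  define r where "r = from_nat_into (rels L) \<circ> to_nat_on (rels L)"
  have "\<phi> \<in> range (map_fm (from_nat_into (funs L)) (from_nat_into (rels L)))"
    if "\<phi> \<in> formulas L n" for \<phi>
  proof -
    have "wf_fm L \<phi>" using that by (simp add: formulas_def)
    note symbols = wf_fm_symbols[OF this]
    have "f s = s" if "s \<in> set1_fm \<phi>" for s
      using symbols that assms unfolding countable_lang_def f_def by auto
    moreover have "r s = s" if "s \<in> set2_fm \<phi>" for s
      using symbols that assms unfolding countable_lang_def r_def by auto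
    ultimately have "map_fm f r \<phi> = map_fm id id \<phi>"
      by (intro fm.map_cong) auto
    then have "\<phi> = map_fm (from_nat_into (funs L)) (from_nat_into (rels L))
        (map_fm (to_nat_on (funs L)) (to_nat_on (rels L)) \<phi>)"
      by (simp add: fm.map_id fm.map_comp f_def r_def)
    then show ?thesis by blast
  qed
  then show ?thesis by (meson countable_subset countableI_type countable_image subsetI)
qed

lemma countable_formulas_over:
  "countable_lang L \<Longrightarrow> countable A \<Longrightarrow> countable (formulas_over L A n)"
  by (intro countable_formulas) (simp add: countable_lang_def lang_with_def)

section \<open>Types\<close>

text \<open>Otherwise completeness puts \<open>Neg \<phi>\<close> into \<open>p\<close>, and a
  realization of \<open>\<Phi>\<close> together with \<open>Neg \<phi>\<close> refutes the
  entailment.\<close>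

lemma types_entailed:
  assumes "p \<in> types L N A n" and "\<Phi> \<subseteq> p" "finite \<Phi>" and "\<phi> \<in> formulas_over L A n"
    and "\<And>d. realizes N n d \<Phi> \<Longrightarrow> holds_at (named N) \<phi> d"
  shows "\<phi> \<in> p"
proof (rule ccontr)
  assume "\<phi> \<notin> p"
  with assms have "insert (Neg \<phi>) \<Phi> \<subseteq> p" by (auto simp: types_def)
  moreover have "finite (insert (Neg \<phi>) \<Phi>)" using assms by simp
  ultimately obtain d where "realizes N n d (insert (Neg \<phi>) \<Phi>)"
    using assms(1) unfolding types_def by blast
  moreover from this have "realizes N n d \<Phi>" by (simp add: realizes_def)
  ultimately show False using assms(5) by (auto simp: realizes_def holds_at_def)
qed

lemma types_Conj:
  assumes p: "p \<in> types L N A n" and \<phi>s: "set \<phi>s \<subseteq> p" and "univ N \<noteq> {}"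
  shows "Conj \<phi>s \<in> p"
proof (rule types_entailed[OF p \<phi>s])
  show "Conj \<phi>s \<in> formulas_over L A n"
    using assms by (auto simp: Conj_in_formulas types_def)
qed (use assms in \<open>auto simp: realizes_def holds_at_def sat_Conj\<close>)

text \<open>Lindenbaum's argument: by Zorn there is a maximal finitely realizable extension, and
  maximality makes it complete.\<close>

lemma extend_to_type:
  assumes "\<Sigma> \<subseteq> formulas_over L A n"
    and "\<And>\<Phi>. \<Phi> \<subseteq> \<Sigma> \<Longrightarrow> finite \<Phi> \<Longrightarrow> \<exists>d. realizes N n d \<Phi>"
  shows "\<exists>q\<in>types L N A n. \<Sigma> \<subseteq> q"
proof -
  define Q where "Q = {q. \<Sigma> \<subseteq> q \<and> q \<subseteq> formulas_over L A n \<and>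
    (\<forall>\<Phi>\<subseteq>q. finite \<Phi> \<longrightarrow> (\<exists>d. realizes N n d \<Phi>))}"
  have "Q \<noteq> {}" using assms by (auto simp: Q_def)
  moreover have "\<Union>C \<in> Q" if C: "C \<noteq> {}" "subset.chain Q C" for C
  proof -
    have "C \<subseteq> Q" using C by (auto simp: subset.chain_def)
    moreover have "\<exists>d. realizes N n d \<Phi>" if \<Phi>: "\<Phi> \<subseteq> \<Union>C" "finite \<Phi>" for \<Phi>
    proof -
      obtain q where "q \<in> C" "\<Phi> \<subseteq> q"
        by (rule finite_subset_Union_chain[OF \<Phi>(2,1) C])
      with \<Phi> \<open>C \<subseteq> Q\<close> show ?thesis by (auto simp: Q_def)
    qed
    moreover have "\<forall>q\<in>C. \<Sigma> \<subseteq> q" using \<open>C \<subseteq> Q\<close> by (auto simp: Q_def)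
    then have "\<Sigma> \<subseteq> \<Union>C" using C(1) by blast
    moreover have "\<Union>C \<subseteq> formulas_over L A n" using \<open>C \<subseteq> Q\<close> by (auto simp: Q_def)
    ultimately show ?thesis by (simp add: Q_def)
  qed
  ultimately obtain q where q: "q \<in> Q" and max: "\<And>q'. q' \<in> Q \<Longrightarrow> q \<subseteq> q' \<Longrightarrow> q' = q"
    using subset_Zorn_nonempty by metis
  have blocked: "\<exists>\<Phi>\<subseteq>insert \<psi> q. finite \<Phi> \<and> (\<nexists>d. realizes N n d \<Phi>)"
    if "\<psi> \<in> formulas_over L A n" "\<psi> \<notin> q" for \<psi>
  proof (rule ccontr)
    assume "\<not> ?thesis"
    then have "insert \<psi> q \<in> Q" using that q by (auto simp: Q_def)
    with max that show False by blast
  qed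
  have "\<phi> \<in> q \<or> Neg \<phi> \<in> q" if \<phi>: "\<phi> \<in> formulas_over L A n" for \<phi>
  proof (rule ccontr)
    assume "\<not> ?thesis"
    then obtain \<Phi> \<Psi> where \<Phi>: "\<Phi> \<subseteq> insert \<phi> q" "finite \<Phi>" "\<nexists>d. realizes N n d \<Phi>"
      and \<Psi>: "\<Psi> \<subseteq> insert (Neg \<phi>) q" "finite \<Psi>" "\<nexists>d. realizes N n d \<Psi>"
      using blocked[of \<phi>] blocked[of "Neg \<phi>"] \<phi> by (auto simp: Neg_in_formulas)
    \<comment> \<open>A realization of what both obstructions use from \<open>q\<close> decides
      \<open>\<phi>\<close> one way, and so realizes one of the two obstructions.\<close>
    have "\<Phi> \<union> \<Psi> - {\<phi>, Neg \<phi>} \<subseteq> q" "finite (\<Phi> \<union> \<Psi> - {\<phi>, Neg \<phi>})"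
      using \<Phi> \<Psi> by auto
    then obtain d where d: "realizes N n d (\<Phi> \<union> \<Psi> - {\<phi>, Neg \<phi>})"
      using q by (fastforce simp: Q_def)
    have "realizes N n d \<Phi> \<or> realizes N n d \<Psi>"
    proof (cases "holds_at (named N) \<phi> d")
      case True
      have "\<Phi> \<subseteq> insert \<phi> (\<Phi> \<union> \<Psi> - {\<phi>, Neg \<phi>})"
        using \<Phi> \<open>\<not> (\<phi> \<in> q \<or> Neg \<phi> \<in> q)\<close> by blast
      with d True have "realizes N n d \<Phi>" unfolding realizes_def by blast
      then show ?thesis ..
    next
      case False
      then have "holds_at (named N) (Neg \<phi>) d" by (simp add: holds_at_def)
      moreover have "\<Psi> \<subseteq> insert (Neg \<phi>) (\<Phi> \<union> \<Psi> - {\<phi>, Neg \<phi>})"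
        using \<Psi> \<open>\<not> (\<phi> \<in> q \<or> Neg \<phi> \<in> q)\<close> by blast
      ultimately have "realizes N n d \<Psi>" using d unfolding realizes_def by blast
      then show ?thesis ..
    qed
    with \<Phi> \<Psi> show False by blast
  qed
  with q show ?thesis by (auto simp: Q_def types_def)
qed

section \<open>Saturation and approximation by points of a set\<close>

text \<open>Saturation speaks of complete types, so \<open>\<Sigma>\<close> is first completed; a
  countable \<open>A\<close> is small because \<open>\<kappa>\<close> is uncountable.\<close>

lemma saturated_realizes_countable:
  assumes "natLeq <o \<kappa>" and "saturated \<kappa> L N" and "A \<subseteq> univ N" "countable A"
    and "\<Sigma> \<subseteq> formulas_over L A n"
    and "\<And>\<Phi>. \<Phi> \<subseteq> \<Sigma> \<Longrightarrow> finite \<Phi> \<Longrightarrow> \<exists>d. realizes N n d \<Phi>"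
  shows "\<exists>d. realizes N n d \<Sigma>"
proof -
  obtain q where q: "q \<in> types L N A n" "\<Sigma> \<subseteq> q"
    using extend_to_type[of \<Sigma>] assms by metis
  have "|A| <o \<kappa>"
    using assms by (simp add: countable_card_le_natLeq ordLeq_ordLess_trans)
  with assms q obtain d where "realizes N n d q"
    unfolding saturated_def by blast
  with q show ?thesis by (auto simp: realizes_def)
qed

text \<open>Enumerate \<open>q\<close> and let \<open>c i\<close> satisfy the conjunction of the
  first \<open>i\<close> formulas, which again belongs to \<open>p\<close>.\<close>

lemma finitely_satisfiable_approximation:
  assumes p: "p \<in> types L N A n" and fs: "finitely_satisfiable_in N n p B"
    and q: "q \<subseteq> p" "countable q" and ne: "univ N \<noteq> {}"
  obtains c where "\<And>i. c i \<in> tuples n B"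
    "\<And>\<theta>. \<theta> \<in> q \<Longrightarrow> eventually (\<lambda>i. holds_at (named N) \<theta> (c i)) sequentially"
proof -
  \<comment> \<open>Adding a true formula makes the set nonempty, so it can be enumerated even if
    \<open>q\<close> is empty.\<close>
  define q' where "q' = insert (Conj []) q"
  have q': "q' \<noteq> {}" "countable q'" "q' \<subseteq> p"
    using q types_Conj[OF p, of "[]"] ne by (auto simp: q'_def)
  define e where "e = from_nat_into q'"
  have e: "range e = q'" using q' by (simp add: e_def)
  have "\<exists>a\<in>tuples n B. \<forall>j<i. holds_at (named N) (e j) a" for i
  proof -
    have "Conj (map e [0..<i]) \<in> p"
      using e q' by (intro types_Conj[OF p _ ne]) auto
    then obtain a where "a \<in> tuples n B" "holds_at (named N) (Conj (map e [0..<i])) a"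
      using fs unfolding finitely_satisfiable_in_def by blast
    then have "\<forall>j<i. holds_at (named N) (e j) a"
      using ne by (simp add: holds_at_def sat_Conj)
    with \<open>a \<in> tuples n B\<close> show ?thesis by blast
  qed
  then obtain c where c: "\<And>i. c i \<in> tuples n B" "\<And>i j. j < i \<Longrightarrow> holds_at (named N) (e j) (c i)"
    by metis
  show thesis
  proof
    fix \<theta> assume "\<theta> \<in> q"
    then obtain j where "\<theta> = e j" using e by (auto simp: q'_def)
    then show "eventually (\<lambda>i. holds_at (named N) \<theta> (c i)) sequentially"
      using c(2) by (auto simp: eventually_sequentially intro!: exI[of _ "Suc j"])
  qed (fact c(1))
qed


section \<open>Alternation along the Morley sequence\<close>

text \<open>The demand that the alternating pattern makes at place \<open>i\<close>.\<close>

definition lit :: "('f, 'r) fm \<Rightarrow> nat \<Rightarrow> ('f, 'r) fm" where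
  "lit \<psi> i = (if even i then \<psi> else Neg \<psi>)"

lemma lit_in_formulas: "lit \<psi> i \<in> formulas L n \<longleftrightarrow> \<psi> \<in> formulas L n"
  by (simp add: lit_def Neg_in_formulas)

lemma sat_lit: "sat N e (lit \<psi> i) \<longleftrightarrow> (sat N e \<psi> \<longleftrightarrow> even i)"
  by (simp add: lit_def)

definition assign :: "nat \<Rightarrow> 'u list \<Rightarrow> nat \<Rightarrow> 'u option" where
  "assign n x j = (if j < n then Some (x ! j) else None)"

lemma ran_assign: "x \<in> tuples n A \<Longrightarrow> ran (assign n x) \<subseteq> A"
  by (auto simp: ran_def assign_def tuples_def split: if_splits)

lemma sat_inst_assign: "sat (named N) e (inst (assign n x) \<phi>) \<longleftrightarrow> sat (named N) (splice n x e) \<phi>"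
proof -
  have "(\<lambda>i. case assign n x i of None \<Rightarrow> e i | Some a \<Rightarrow> a) = splice n x e"
    by (rule ext) (simp add: assign_def splice_def)
  then show ?thesis by (simp add: sat_inst)
qed

lemma inst_in_formulas:
  assumes "\<phi> \<in> formulas_over L A K" and "x \<in> tuples n A"
  shows "inst (assign n x) \<phi> \<in> formulas_over L A K"
  using assms(1) wf_inst[OF _ ran_assign[OF assms(2)]] by (auto simp: formulas_def fv_inst)

text \<open>One common \<open>y\<close>, the values of \<open>e\<close> on \<open>{n..<K}\<close>,
  makes \<open>\<psi>(a i, y)\<close> true exactly at the even \<open>i < N\<close>.\<close>

definition alternates ::
  "('f, 'r, 'u) struct \<Rightarrow> nat \<Rightarrow> nat \<Rightarrow> ('f + 'u, 'r) fm \<Rightarrow> nat \<Rightarrow> (nat \<Rightarrow> 'u list) \<Rightarrow> bool" where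
  "alternates U n K \<psi> N a \<longleftrightarrow>
     (\<exists>e. (\<forall>j\<in>{n..<K}. e j \<in> univ U) \<and> (\<forall>i<N. sat (named U) (splice n (a i) e) (lit \<psi> i)))"

text \<open>Name all entries other than the \<open>k\<close>-th by constants and quantify
  \<open>y\<close> away: alternation becomes a property \<open>\<theta>(x)\<close> of the
  \<open>k\<close>-th entry alone. Nothing is required of \<open>a k\<close>, as it is
  overwritten.\<close>

lemma alternates_definable:
  assumes ne: "univ U \<noteq> {}" and nK: "n \<le> K" and \<psi>: "\<psi> \<in> formulas_over L {} K"
    and a: "\<And>i. i \<noteq> k \<Longrightarrow> a i \<in> tuples n A"
  obtains \<theta> where "\<theta> \<in> formulas_over L A n"
    "\<And>x. holds_at (named U) \<theta> x \<longleftrightarrow> alternates U n K \<psi> N (a(k := x))"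
proof -
  define \<beta> where "\<beta> i = (if i = k then lit \<psi> i else inst (assign n (a i)) (lit \<psi> i))" for i
  define \<theta> where "\<theta> = foldr Exists [n..<K] (Conj (map \<beta> [0..<N]))"
  have \<psi>A: "lit \<psi> i \<in> formulas_over L A K" for i
    using \<psi> formulas_over_mono[of "{}" A L K] by (auto simp: lit_in_formulas)
  then have "\<beta> i \<in> formulas_over L A K" for i
    by (auto simp: \<beta>_def intro!: inst_in_formulas a)
  then have "Conj (map \<beta> [0..<N]) \<in> formulas_over L A K"
    by (auto simp: Conj_in_formulas)
  then have "wf_fm (lang_with L A) \<theta>" and "fv \<theta> \<subseteq> {..<K} - {n..<K}"
    unfolding \<theta>_def formulas_def by (auto simp: fv_Exists_list wf_Exists_list)
  moreover have "{..<K} - {n..<K} \<subseteq> {..<n}" by auto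
  ultimately have "\<theta> \<in> formulas_over L A n" unfolding formulas_def by blast
  moreover have "holds_at (named U) \<theta> x \<longleftrightarrow> alternates U n K \<psi> N (a(k := x))" for x
  proof -
    have "sat (named U) (\<lambda>j. if j \<in> set [n..<K] then e j else x ! j) (\<beta> i) \<longleftrightarrow>
        sat (named U) (splice n ((a(k := x)) i) e) (lit \<psi> i)" for e i
    proof (cases "i = k")
      case True
      have "fv (lit \<psi> i) \<subseteq> {..<K}" using \<psi>A[of i] by (simp add: formulas_def)
      with True show ?thesis
        by (auto simp: \<beta>_def splice_def intro!: sat_cong)
    next
      case False
      have "fv (lit \<psi> i) \<subseteq> {..<K}" using \<psi>A[of i] by (simp add: formulas_def)
      with False show ?thesis
        by (auto simp: \<beta>_def sat_inst_assign splice_def intro!: sat_cong)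
    qed
    then have "alternates U n K \<psi> N (a(k := x)) \<longleftrightarrow>
        (\<exists>e. (\<forall>j\<in>{n..<K}. e j \<in> univ U) \<and>
          (\<forall>i<N. sat (named U) (\<lambda>j. if j \<in> set [n..<K] then e j else x ! j) (\<beta> i)))"
      unfolding alternates_def by blast
    then show ?thesis
      using ne by (auto simp: holds_at_def \<theta>_def sat_Exists_list sat_Conj)
  qed
  ultimately show thesis by (rule that)
qed

text \<open>Density says that within \<open>B\<close>, every formula of \<open>p\<close> over
  \<open>B\<close> and the \<open>d j\<close> has solutions with either truth value of
  \<open>\<psi>(x, b)\<close>. This allows the points of \<open>B\<close> to be exchanged for the
  \<open>d j\<close> one at a time.\<close>

lemma morley_sequence_alternates:
  assumes ne: "univ U \<noteq> {}" and nK: "n \<le> K" and \<psi>: "\<psi> \<in> formulas_over L {} K"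
    and B: "B \<subseteq> univ U" and p: "p \<in> global_types L U n" and d: "morley_sequence L U n p B d"
    and b: "\<And>j. b j \<in> univ U"
    and dense: "\<And>\<theta> i. \<theta> \<in> restrict_type L n p (B \<union> (\<Union>j. set (d j))) \<Longrightarrow>
      \<exists>m\<in>tuples n B. holds_at (named U) \<theta> m \<and> sat (named U) (splice n m b) (lit \<psi> i)"
  shows "alternates U n K \<psi> N d"
proof -
  have dU: "d i \<in> tuples n (univ U)" for i
    using d by (simp add: morley_sequence_def realizes_def)
  \<comment> \<open>Here \<open>m\<close> must stay arbitrary: the induction hypothesis is applied
    to \<open>m\<close> with a new \<open>k\<close>-th entry. At \<open>k = 0\<close> the witness
    for \<open>y\<close> is \<open>b\<close>.\<close>
  have step: "alternates U n K \<psi> N (\<lambda>i. if i < k then d i else m i)"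
    if "\<And>i. m i \<in> tuples n B \<and> sat (named U) (splice n (m i) b) (lit \<psi> i)" for k m
    using that
  proof (induction k arbitrary: m)
    case 0
    then show ?case using b by (auto simp: alternates_def)
  next
    case (Suc k)
    define a where "a i = (if i < Suc k then d i else m i)" for i
    \<comment> \<open>Entries of \<open>a\<close> after the \<open>k\<close>-th lie in
      \<open>B\<close>, so \<open>\<theta>\<close> needs only parameters over which
      \<open>d k\<close> realizes \<open>p\<close>.\<close>
    define A where "A = B \<union> (\<Union>j<k. set (d j))"
    have "a i \<in> tuples n A" if "i \<noteq> k" for i
      using that Suc.prems[of i] dU[of i] by (auto simp: a_def A_def tuples_def)
    then obtain \<theta> where \<theta>: "\<theta> \<in> formulas_over L A n"
      and sat_\<theta>: "\<And>x. holds_at (named U) \<theta> x \<longleftrightarrow> alternates U n K \<psi> N (a(k := x))"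
      using alternates_definable[OF ne nK \<psi>, of k a A N] by metis
    have "A \<subseteq> univ U" using B dU by (fastforce simp: A_def tuples_def)
    then have "\<theta> \<in> formulas_over L (univ U) n"
      using \<theta> formulas_over_mono by blast
    then have \<theta>p: "\<theta> \<in> p \<or> Neg \<theta> \<in> p" using p by (simp add: types_def)
    have "alternates U n K \<psi> N a"
    proof (rule ccontr)
      assume "\<not> ?thesis"
      \<comment> \<open>If \<open>\<theta>\<close> were in \<open>p\<close>, then \<open>d k\<close>
        would satisfy it, and \<open>a\<close> would alternate.\<close>
      moreover have "Neg \<theta> \<in> p"
      proof (rule ccontr)
        assume "Neg \<theta> \<notin> p"
        with \<theta>p \<theta> have "\<theta> \<in> restrict_type L n p A" by (simp add: restrict_type_def)
        then have "holds_at (named U) \<theta> (d k)"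
          using d by (auto simp: morley_sequence_def realizes_def A_def)
        moreover have "a(k := d k) = a" by (auto simp: a_def)
        ultimately show False using sat_\<theta> \<open>\<not> alternates U n K \<psi> N a\<close> by simp
      qed
      moreover have "formulas_over L A n \<subseteq> formulas_over L (B \<union> (\<Union>j. set (d j))) n"
        by (rule formulas_over_mono) (auto simp: A_def)
      ultimately have "Neg \<theta> \<in> restrict_type L n p (B \<union> (\<Union>j. set (d j)))"
        using \<theta> by (auto simp: restrict_type_def Neg_in_formulas)
      \<comment> \<open>Density yields an \<open>x\<close> in \<open>B\<close> that fits the pattern
        at \<open>k\<close> along \<open>b\<close> but violates \<open>\<theta>\<close>; the
        induction hypothesis with \<open>x\<close> at place \<open>k\<close> says the
        opposite.\<close>
      then obtain x where x: "x \<in> tuples n B" "\<not> holds_at (named U) \<theta> x"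
          "sat (named U) (splice n x b) (lit \<psi> k)"
        using dense[of "Neg \<theta>" k] by (auto simp: holds_at_def)
      have "alternates U n K \<psi> N (\<lambda>i. if i < k then d i else (m(k := x)) i)"
        by (rule Suc.IH) (use Suc.prems x in auto)
      moreover have "(\<lambda>i. if i < k then d i else (m(k := x)) i) = a(k := x)"
        by (auto simp: a_def)
      ultimately show False using x sat_\<theta> by simp
    qed
    then show ?case by (simp add: a_def[abs_def])
  qed
  have "Conj [] \<in> restrict_type L n p (B \<union> (\<Union>j. set (d j)))"
    using types_Conj[OF p, of "[]"] ne by (simp add: restrict_type_def Conj_in_formulas)
  then have "\<exists>m\<in>tuples n B. sat (named U) (splice n m b) (lit \<psi> i)" for i
    using dense[of "Conj []" i] by blast
  then obtain m where "\<And>i. m i \<in> tuples n B \<and> sat (named U) (splice n (m i) b) (lit \<psi> i)"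
    by metis
  \<comment> \<open>For \<open>k = N\<close> the remaining \<open>m i\<close> are out of sight, as
    only places below \<open>N\<close> count.\<close>
  from step[of m N, OF this] show ?thesis by (simp add: alternates_def cong: conj_cong)
qed

text \<open>The conditions on \<open>y\<close> at all places form a countable set over the countable
  \<open>D\<close>, finitely satisfiable by \<open>alt\<close>. Saturation gives one
  \<open>y\<close> for all of them, and \<open>\<psi>(x, y)\<close> then changes its truth value
  along \<open>d\<close> forever.\<close>

lemma alternates_imp_not_converges:
  assumes \<kappa>: "natLeq <o \<kappa>" "saturated \<kappa> L U" and ne: "univ U \<noteq> {}"
    and nK: "n \<le> K" and \<psi>: "\<psi> \<in> formulas_over L {} K"
    and d: "\<And>i. d i \<in> tuples n (univ U)" and alt: "\<And>N. alternates U n K \<psi> N d"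
  shows "\<not> converges L U n d"
proof
  assume conv: "converges L U n d"
  define D where "D = (\<Union>i. set (d i))"
  define \<beta> where "\<beta> i = inst (assign n (d i)) (lit \<psi> i)" for i
  have dD: "d i \<in> tuples n D" for i using d by (auto simp: tuples_def D_def)
  have \<psi>A: "lit \<psi> i \<in> formulas_over L A K" for i A
    using \<psi> formulas_over_mono[of "{}" A L K] by (auto simp: lit_in_formulas)
  have fv: "fv (lit \<psi> i) \<subseteq> {..<K}" for i
    using \<psi>A[of i "{}"] by (simp add: formulas_def)
  obtain u where u: "u \<in> univ U" using ne by blast
  have "\<exists>x. realizes U K x \<Phi>" if \<Phi>: "\<Phi> \<subseteq> range \<beta>" "finite \<Phi>" for \<Phi>
  proof -
    obtain I where I: "\<Phi> = \<beta> ` I" "finite I" using finite_subset_image[OF \<Phi>(2,1)] by metis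
    then obtain N where "I \<subseteq> {..<N}" by (auto simp: finite_nat_iff_bounded)
    moreover obtain e where e: "\<forall>j\<in>{n..<K}. e j \<in> univ U"
      "\<forall>i<N. sat (named U) (splice n (d i) e) (lit \<psi> i)"
      using alt[of N] by (auto simp: alternates_def)
    \<comment> \<open>The first \<open>n\<close> coordinates are padding: in
      \<open>\<beta> i\<close> these variables have been replaced by the entries of
      \<open>d i\<close>.\<close>
    define x where "x = map (\<lambda>j. if n \<le> j then e j else u) [0..<K]"
    have "holds_at (named U) (\<beta> i) x \<longleftrightarrow> sat (named U) (splice n (d i) e) (lit \<psi> i)" for i
      unfolding holds_at_def \<beta>_def sat_inst_assign
      using fv[of i] by (intro sat_cong) (auto simp: splice_def x_def)
    moreover have "x \<in> tuples K (univ U)" using e u by (auto simp: x_def tuples_def)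
    ultimately have "realizes U K x \<Phi>" using e I by (auto simp: realizes_def)
    then show ?thesis ..
  qed
  moreover have "range \<beta> \<subseteq> formulas_over L D K"
    using inst_in_formulas[OF \<psi>A dD] by (auto simp: \<beta>_def)
  moreover have "countable D" by (simp add: D_def countable_finite)
  moreover have "D \<subseteq> univ U" using d by (auto simp: D_def tuples_def)
  ultimately obtain y where y: "y \<in> tuples K (univ U)" "\<And>i. holds_at (named U) (\<beta> i) y"
    using saturated_realizes_countable[OF \<kappa>, of D "range \<beta>" K] by (auto simp: realizes_def)
  define s where "s j = (if n \<le> j \<and> j < K then Some (y ! j) else None)" for j
  have "ran s \<subseteq> univ U" using y by (auto simp: s_def ran_def tuples_def split: if_splits)
  moreover have "dom s = {n..<K}" by (auto simp: s_def dom_def)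
  moreover have "\<psi> \<in> formulas_over L (univ U) K"
    using \<psi> formulas_over_mono[of "{}" "univ U" L K] by blast
  ultimately have "wf_fm (lang_with L (univ U)) (inst s \<psi>)" "fv (inst s \<psi>) \<subseteq> {..<K} - {n..<K}"
    by (auto simp: formulas_def fv_inst wf_inst)
  moreover have "{..<K} - {n..<K} \<subseteq> {..<n}" by auto
  ultimately have "inst s \<psi> \<in> formulas_over L (univ U) n" unfolding formulas_def by blast
  moreover have "holds_at (named U) (inst s \<psi>) (d i) \<longleftrightarrow> even i" for i
  proof -
    have "holds_at (named U) (inst s \<psi>) (d i) \<longleftrightarrow> sat (named U) (splice n (d i) (\<lambda>j. y ! j)) \<psi>"
      unfolding holds_at_def sat_inst
      using \<psi> by (intro sat_cong) (auto simp: formulas_def s_def splice_def)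
    also have "\<dots> \<longleftrightarrow> even i"
      using y(2)[of i] by (simp add: holds_at_def \<beta>_def sat_inst_assign sat_lit)
    finally show ?thesis .
  qed
  ultimately have "eventually even sequentially \<or> eventually odd sequentially"
    using conv unfolding converges_iff[where d = d, OF d] by auto
  then obtain N :: nat where "(\<forall>i\<ge>N. even i) \<or> (\<forall>i\<ge>N. odd i)"
    unfolding eventually_sequentially by blast
  then have "even N \<and> even (Suc N) \<or> odd N \<and> odd (Suc N)"
    by (meson le_Suc_eq order_refl)
  then show False by simp
qed

theorem theorem2p11:
  fixes L :: "('f, 'r) lang" and T :: "('f, 'r) fm set"
    and \<kappa> :: "'k rel" and U M :: "('f, 'r, 'u) struct"
    and n :: nat and p :: "('f + 'u, 'r) fm set" and d :: "nat \<Rightarrow> 'u list"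
  assumes "countable_lang L"
    and "complete_theory L T"
    and "monster_model \<kappa> L T U"
    and "is_model L M T" and "elem_substruct L M U" and "countable (univ M)"
    and "p \<in> global_types L U n"
    and "finitely_satisfiable_in U n p (univ M)"
    and "morley_sequence L U n p (univ M) d"
    and "converges L U n d"
  shows "\<exists>c. (\<forall>i. c i \<in> tuples n (univ M)) \<and> types_tend_to L U n c p"
proof -
  let ?M = "univ M" and ?N = "named U"
  define D where "D = ?M \<union> (\<Union>i. set (d i))"
  define q where "q = restrict_type L n p D"
  have \<kappa>: "natLeq <o \<kappa>" "saturated \<kappa> L U" and ne: "univ U \<noteq> {}"
    using assms(3) by (auto simp: monster_model_def is_model_def is_struct_def)
  have MU: "?M \<subseteq> univ U" using assms(5) by (simp add: elem_substruct_def)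
  note p = assms(7) and fs = assms(8)
  have d: "d i \<in> tuples n (univ U)" for i
    using assms(9) by (simp add: morley_sequence_def realizes_def)
  have "countable D" using assms(6) by (simp add: D_def countable_finite)
  then have "countable q"
    using countable_formulas_over[OF assms(1)]
    by (auto simp: q_def restrict_type_def intro: countable_subset)
  then obtain c where c: "\<And>i. c i \<in> tuples n ?M"
    and lim: "\<And>\<theta>. \<theta> \<in> q \<Longrightarrow> eventually (\<lambda>i. holds_at ?N \<theta> (c i)) sequentially"
    using finitely_satisfiable_approximation[OF p fs, of q] ne
    by (auto simp: q_def restrict_type_def)
  have cU: "c i \<in> tuples n (univ U)" for i
    using c[of i] MU by (auto simp: tuples_def)
  \<comment> \<open>It suffices to treat the formulas in \<open>p\<close>: applied to negations,
    this also excludes those outside.\<close>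
  have main: "eventually (\<lambda>i. holds_at ?N \<phi> (c i)) sequentially" if \<phi>p: "\<phi> \<in> p" for \<phi>
  proof (rule ccontr)
    assume *: "\<not> ?thesis"
    have "\<phi> \<in> formulas_over L (univ U) n" using \<phi>p p by (auto simp: types_def)
    then obtain \<psi> K b where nK: "n \<le> K" and \<psi>: "\<psi> \<in> formulas_over L {} K"
      and b: "\<And>j. b j \<in> univ U"
      and \<phi>\<psi>: "\<And>x. holds_at ?N \<phi> x \<longleftrightarrow> sat ?N (splice n x b) \<psi>"
      using separate_parameters ne by (metis ex_in_conv)
    have "\<exists>m\<in>tuples n ?M. holds_at ?N \<theta> m \<and> sat ?N (splice n m b) (lit \<psi> i)"
      if "\<theta> \<in> restrict_type L n p (?M \<union> (\<Union>j. set (d j)))" for \<theta> i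
    proof -
      have \<theta>: "\<theta> \<in> q" using that by (simp add: q_def D_def)
      show ?thesis
      proof (cases "even i")
        case True
        \<comment> \<open>A solution satisfying \<open>\<phi>\<close> comes from finite
          satisfiability of the conjunction.\<close>
        have "Conj [\<theta>, \<phi>] \<in> p"
          using \<theta> \<phi>p by (intro types_Conj[OF p _ ne]) (auto simp: q_def restrict_type_def)
        then obtain m where "m \<in> tuples n ?M" "holds_at ?N (Conj [\<theta>, \<phi>]) m"
          using fs unfolding finitely_satisfiable_in_def by blast
        with True ne show ?thesis
          by (auto simp: holds_at_def sat_Conj sat_lit \<phi>\<psi>[unfolded holds_at_def])
      next
        case False
        \<comment> \<open>A solution violating \<open>\<phi>\<close> is some \<open>c j\<close>:
          infinitely many violate \<open>\<phi>\<close>, and almost all satisfy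
          \<open>\<theta>\<close>.\<close>
        have "frequently (\<lambda>i. \<not> holds_at ?N \<phi> (c i)) sequentially"
          using * by (simp add: frequently_def)
        then have "frequently (\<lambda>i. \<not> holds_at ?N \<phi> (c i) \<and> holds_at ?N \<theta> (c i)) sequentially"
          using lim[OF \<theta>] by (rule frequently_eventually_frequently)
        then obtain j where "\<not> holds_at ?N \<phi> (c j)" "holds_at ?N \<theta> (c j)"
          by (auto dest: frequently_ex)
        with False c show ?thesis by (auto simp: sat_lit \<phi>\<psi>)
      qed
    qed
    then have "alternates U n K \<psi> N d" for N
      by (rule morley_sequence_alternates[OF ne nK \<psi> MU p assms(9) b])
    then show False
      using alternates_imp_not_converges[where d = d, OF \<kappa> ne nK \<psi> d] assms(10) by blast
  qed
  have "\<phi> \<in> p" if "\<phi> \<in> formulas_over L (univ U) n"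
    and "eventually (\<lambda>i. holds_at ?N \<phi> (c i)) sequentially" for \<phi>
  proof (rule ccontr)
    assume "\<phi> \<notin> p"
    then have "Neg \<phi> \<in> p" using p that by (auto simp: types_def)
    from main[OF this] that(2) have "eventually (\<lambda>i. False) sequentially"
      by eventually_elim (simp add: holds_at_def)
    then show False by simp
  qed
  then have "types_tend_to L U n c p"
    unfolding types_tend_to_iff[where c = c, OF cU p] using main by blast
  with c show ?thesis by blast
qed

end
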